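(* Consider the POMDP multi-armed bandit with $L$ independent projects in which all $L$ projects have identical transition matrix $P$, observation matrix $B$ and reward vector $r=[r(1),\dots,r(X)]'$. Suppose $r(i)$ is increasing in $i\in\{1,\dots,X\}$, $B$ is totally positive of order 2 (TP2), and $P$ is TP2. Then the Gittins index $\gamma(\pi)$ is MLR increasing in $\pi$. Therefore, if the beliefs $\pi_k^{(l)}$ of the $L$ projects are MLR comparable, then the optimal policy $\mu^*$ is opportunistic: $$u_k=\mu^*(\pi_k^{(1)},\dots,\pi_k^{(L)})=\arg\max_{l\in\{1,\dots,L\}}\pi_k^{(l)},$$ where the maximum is with respect to the MLR order.
   Context: POMDP multi-armed bandit: project $l\in\{1,\dots,L\}$ has state $x_k^{(l)}\in\{1,\dots,X\}$. At each time $k$ exactly one project $u_k$ is worked on. If project $l$ is worked on at time $k$: a nonnegative reward $\rho^k r(x_k^{(l)})$ is accrued ($0\le\rho<1$), its state evolves by the transition matrix $P$, and an observation $y_{k+1}^{(l)}\in\{1,\dots,Y\}$ of $x_{k+1}^{(l)}$ is obtained with probabilities $B_{xy}=\mathbb P(y^{(l)}=y\mid x^{(l)}=x)$. The states of idle projects do not change and no observations of idle projects are obtained. The belief $\pi_k^{(l)}$ is the conditional pmf of $x_k^{(l)}$ given the observation/action history; for the active project it is updated as $\pi_{k+1}^{(l)}=T(\pi_k^{(l)},y_{k+1}^{(l)})$, $T(\pi,y)=B_yP'\pi/\sigma(\pi,y)$, $\sigma(\pi,y)=\mathbf 1'B_yP'\pi$, $B_y=\mathrm{diag}(B_{1y},\dots,B_{Xy})$;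 for idle projects the belief is unchanged. The aim is to maximize $\mathbb E\{\sum_{k\ge0}\rho^k r'\pi_k^{(u_k)}\}$ over stationary policies $u_k=\mu(\pi_k^{(1)},\dots,\pi_k^{(L)})$. Gittins index: with $M$ a scalar in $[0,\max_i r(i)/(1-\rho)]$, let $V(\pi,M)$ solve $V(\pi,M)=\max\{r'\pi+\rho\sum_{y=1}^Y V(T(\pi,y),M)\sigma(\pi,y),\ M\}$, and set $\gamma(\pi)=\min\{M:V(\pi,M)=M\}$. It is a known fact that an optimal policy is to work at each time on the project with the largest Gittins index $\gamma(\pi_k^{(l)})$; $\mu^*$ denotes this policy. MLR order on probability vectors: $\pi_1\ge_r\pi_2$ means $\pi_1(i)\pi_2(j)\le\pi_2(i)\pi_1(j)$ for all $i<j$; a function $\phi$ is MLR increasing if $\pi_1\ge_r\pi_2$ implies $\phi(\pi_1)\ge\phi(\pi_2)$. A stochastic matrix is TP2 if all its second order minors are nonnegative. "Increasing" is in the weak sense. *)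

theory Defs
  imports "HOL-Analysis.Analysis"
begin

text \<open>
  States, observations and projects are indexed by finite types; the linear orders on the
  first two play the role of the orders on \<open>{1..X}\<close> and \<open>{1..Y}\<close>.
\<close>

definition beliefs :: "(real^'x) set" where
  "beliefs = {\<pi>. (\<forall>i. 0 \<le> \<pi> $ i) \<and> (\<Sum>i\<in>UNIV. \<pi> $ i) = 1}"

definition stochastic_matrix :: "real^'n^'m \<Rightarrow> bool" where
  "stochastic_matrix A \<longleftrightarrow> (\<forall>i. A $ i \<in> beliefs)"

definition TP2 :: "real^'n::{finite,linorder}^'m::{finite,linorder} \<Rightarrow> bool" where
  "TP2 A \<longleftrightarrow> (\<forall>i i' j j'. i < i' \<longrightarrow> j < j' \<longrightarrow>
     0 \<le> A $ i $ j * A $ i' $ j' - A $ i $ j' * A $ i' $ j)"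

definition mlr_ge :: "real^'x::{finite,linorder} \<Rightarrow> real^'x::{finite,linorder} \<Rightarrow> bool" (infix "\<ge>\<^sub>r" 50) where
  "\<pi>\<^sub>1 \<ge>\<^sub>r \<pi>\<^sub>2 \<longleftrightarrow> (\<forall>i j. i < j \<longrightarrow> \<pi>\<^sub>1 $ i * \<pi>\<^sub>2 $ j \<le> \<pi>\<^sub>2 $ i * \<pi>\<^sub>1 $ j)"

definition mlr_increasing :: "(real^'x::{finite,linorder} \<Rightarrow> real) \<Rightarrow> bool" where
  "mlr_increasing \<phi> \<longleftrightarrow> (\<forall>\<pi>\<^sub>1\<in>beliefs. \<forall>\<pi>\<^sub>2\<in>beliefs. \<pi>\<^sub>1 \<ge>\<^sub>r \<pi>\<^sub>2 \<longrightarrow> \<phi> \<pi>\<^sub>1 \<ge> \<phi> \<pi>\<^sub>2)"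


subsection \<open>Filter for a single project\<close>

definition obs_diag :: "real^'y^'x \<Rightarrow> 'y \<Rightarrow> real^'x^'x" where
  "obs_diag B y = (\<chi> i j. if i = j then B $ i $ y else 0)"

definition obs_prob :: "real^'x^'x \<Rightarrow> real^'y^'x \<Rightarrow> real^'x \<Rightarrow> 'y \<Rightarrow> real" where
  "obs_prob P B \<pi> y = 1 \<bullet> (obs_diag B y *v (transpose P *v \<pi>))"

text \<open>
  If \<open>obs_prob P B \<pi> y = 0\<close>, the update below is the zero vector and not a belief; it then only
  ever occurs multiplied by \<open>obs_prob P B \<pi> y\<close>.
\<close>

definition belief_update :: "real^'x^'x \<Rightarrow> real^'y^'x \<Rightarrow> real^'x \<Rightarrow> 'y \<Rightarrow> real^'x" where
  "belief_update P B \<pi> y =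
     (1 / obs_prob P B \<pi> y) *\<^sub>R (obs_diag B y *v (transpose P *v \<pi>))"


subsection \<open>Gittins index\<close>

definition retirement_rewards :: "real^'x \<Rightarrow> real \<Rightarrow> real set" where
  "retirement_rewards r \<rho> = {0 .. Max (range (\<lambda>i. r $ i)) / (1 - \<rho>)}"

text \<open>
  Boundedness singles out the value function: among bounded functions on the belief simplex
  the solution is unique, whereas unbounded spurious solutions may exist.
\<close>

definition retirement_value ::
    "real^'x^'x \<Rightarrow> real^'y^'x \<Rightarrow> real^'x \<Rightarrow> real \<Rightarrow> (real^'x \<Rightarrow> real \<Rightarrow> real) \<Rightarrow> bool" where
  "retirement_value P B r \<rho> V \<longleftrightarrow>
     (\<forall>M\<in>retirement_rewards r \<rho>.
        bounded ((\<lambda>\<pi>. V \<pi> M) ` beliefs) \<and>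
        (\<forall>\<pi>\<in>beliefs. V \<pi> M =
           max (r \<bullet> \<pi> + \<rho> * (\<Sum>y\<in>UNIV. V (belief_update P B \<pi> y) M * obs_prob P B \<pi> y)) M))"

definition gittins_index ::
    "real^'x \<Rightarrow> real \<Rightarrow> (real^'x \<Rightarrow> real \<Rightarrow> real) \<Rightarrow> real^'x \<Rightarrow> real" where
  "gittins_index r \<rho> V \<pi> = (LEAST M. M \<in> retirement_rewards r \<rho> \<and> V \<pi> M = M)"


subsection \<open>Bandit with identical projects\<close>

type_synonym ('x, 'l) policy = "('l \<Rightarrow> real^'x) \<Rightarrow> 'l"

definition profiles :: "('l \<Rightarrow> real^'x) set" where
  "profiles = {b. \<forall>l. b l \<in> beliefs}"

text \<open>
  \<open>stage_reward P B r \<mu> k b\<close> is the expectation of \<open>r'\<pi>\<^sub>k\<close> for the project active at time \<open>k\<close>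
  when policy \<open>\<mu>\<close> is started in the belief profile \<open>b\<close>: given the history, the active project
  with belief \<open>\<pi>\<close> emits \<open>y\<close> with probability \<open>obs_prob P B \<pi> y\<close>, and only its belief changes.
\<close>

primrec stage_reward ::
    "real^'x^'x \<Rightarrow> real^'y^'x \<Rightarrow> real^'x \<Rightarrow> ('x, 'l) policy \<Rightarrow> nat \<Rightarrow> ('l \<Rightarrow> real^'x) \<Rightarrow> real" where
  "stage_reward P B r \<mu> 0 b = r \<bullet> b (\<mu> b)"
| "stage_reward P B r \<mu> (Suc k) b =
     (\<Sum>y\<in>UNIV. obs_prob P B (b (\<mu> b)) y *
        stage_reward P B r \<mu> k (b(\<mu> b := belief_update P B (b (\<mu> b)) y)))"

definition discounted_reward ::
    "real^'x^'x \<Rightarrow> real^'y^'x \<Rightarrow> real^'x \<Rightarrow> real \<Rightarrow> ('x, 'l) policy \<Rightarrow> ('l \<Rightarrow> real^'x) \<Rightarrow> real" where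
  "discounted_reward P B r \<rho> \<mu> b = (\<Sum>k. \<rho> ^ k * stage_reward P B r \<mu> k b)"

definition optimal_policy ::
    "real^'x^'x \<Rightarrow> real^'y^'x \<Rightarrow> real^'x \<Rightarrow> real \<Rightarrow> ('x, 'l) policy \<Rightarrow> bool" where
  "optimal_policy P B r \<rho> \<mu> \<longleftrightarrow>
     (\<forall>b\<in>profiles. \<forall>\<mu>'. discounted_reward P B r \<rho> \<mu>' b \<le> discounted_reward P B r \<rho> \<mu> b)"

definition index_argmax :: "(real^'x \<Rightarrow> real) \<Rightarrow> ('l \<Rightarrow> real^'x) \<Rightarrow> 'l set" where
  "index_argmax \<gamma> b = {l. \<forall>m. \<gamma> (b m) \<le> \<gamma> (b l)}"

definition mlr_argmax :: "('l \<Rightarrow> real^'x::{finite,linorder}) \<Rightarrow> 'l set" where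
  "mlr_argmax b = {l. \<forall>m. b l \<ge>\<^sub>r b m}"

definition mlr_comparable :: "('l \<Rightarrow> real^'x::{finite,linorder}) \<Rightarrow> bool" where
  "mlr_comparable b \<longleftrightarrow> (\<forall>l m. b l \<ge>\<^sub>r b m \<or> b m \<ge>\<^sub>r b l)"

definition index_policy :: "(real^'x \<Rightarrow> real) \<Rightarrow> ('x, 'l) policy \<Rightarrow> bool" where
  "index_policy \<gamma> \<mu> \<longleftrightarrow> (\<forall>b\<in>profiles. \<mu> b \<in> index_argmax \<gamma> b)"

text \<open>
  The index need not be strictly increasing (it is constant if \<open>r\<close> is), so several projects with
  different, comparable beliefs may attain the largest index.  The following convention says that
  the project chosen among these is not MLR dominated by another of them.
\<close>

definition mlr_tie_breaking ::
    "(real^'x::{finite,linorder} \<Rightarrow> real) \<Rightarrow> ('x::{finite,linorder}, 'l) policy \<Rightarrow> bool" where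
  "mlr_tie_breaking \<gamma> \<mu> \<longleftrightarrow>
     (\<forall>b\<in>profiles. \<forall>l\<in>index_argmax \<gamma> b. b l \<ge>\<^sub>r b (\<mu> b) \<longrightarrow> b l = b (\<mu> b))"

definition opportunistic :: "('x::{finite,linorder}, 'l) policy \<Rightarrow> bool" where
  "opportunistic \<mu> \<longleftrightarrow> (\<forall>b\<in>profiles. mlr_comparable b \<longrightarrow> \<mu> b \<in> mlr_argmax b)"

end

theory Submission
  imports Defs
begin

text \<open>
  The whole argument rests on comparing two observations \<open>y' \<le> y\<close> at once: if \<open>\<pi>\<^sub>1 \<ge>\<^sub>r \<pi>\<^sub>2\<close>, then
  \<open>T(\<pi>\<^sub>1,y) \<ge>\<^sub>r T(\<pi>\<^sub>2,y')\<close> whenever both are defined, and the observation law under \<open>\<pi>\<^sub>1\<close>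
  MLR dominates the one under \<open>\<pi>\<^sub>2\<close>.  Hence if \<open>V(\<pi>\<^sub>2,M) - V(\<pi>\<^sub>1,M) \<le> c\<close> for all comparable pairs,
  then the Bellman equation improves the bound to \<open>max (\<rho>c) 0\<close>, so the supremum of these
  differences is at most 0 and \<open>V(\<cdot>,M)\<close> is MLR increasing.  The same contraction argument shows
  that \<open>V(\<pi>,\<cdot>)\<close> is 1-Lipschitz and that \<open>V(\<pi>,M) = M\<close> for the largest \<open>M\<close>, so the minimum defining the
  index exists; as \<open>V \<ge> M\<close>, the set of such \<open>M\<close> shrinks when \<open>\<pi>\<close> increases.
\<close>

text \<open>Swapping the summation indices writes twice the sum as a sum of symmetrized terms. This
  serves kernels whose sign is only known after pairing \<open>(i,j)\<close> with
  \<open>(j,i)\<close>.\<close>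

lemma double_sum_nonneg_if_symmetrized_nonneg:
  fixes g :: "'a::finite \<Rightarrow> 'a \<Rightarrow> real"
  assumes "\<And>i j. 0 \<le> g i j + g j i"
  shows "0 \<le> (\<Sum>i\<in>UNIV. \<Sum>j\<in>UNIV. g i j)"
proof -
  have "0 \<le> (\<Sum>i\<in>UNIV. \<Sum>j\<in>UNIV. g i j + g j i)"
    by (intro sum_nonneg assms)
  also have "\<dots> = (\<Sum>i\<in>UNIV. \<Sum>j\<in>UNIV. g i j) + (\<Sum>i\<in>UNIV. \<Sum>j\<in>UNIV. g j i)"
    by (simp add: sum.distrib)
  also have "(\<Sum>i\<in>UNIV. \<Sum>j\<in>UNIV. g j i) = (\<Sum>i\<in>UNIV. \<Sum>j\<in>UNIV. g i j)"
    by (rule sum.swap)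
  finally show ?thesis by simp
qed

text \<open>Taking \<open>c = Sup S\<close> gives \<open>Sup S \<le> max (\<rho> * Sup S) e\<close>,
  which is impossible if \<open>Sup S > e\<close>, because then
  \<open>\<rho> * Sup S < Sup S\<close>. With \<open>S\<close> a bounded set of differences of
  values, estimates follow from the Bellman equation without iterating it.\<close>

lemma le_of_contraction:
  fixes S :: "real set"
  assumes \<rho>: "0 \<le> \<rho>" "\<rho> < 1" and e: "0 \<le> e" and S: "bdd_above S"
    and step: "\<And>c s. (\<And>t. t \<in> S \<Longrightarrow> t \<le> c) \<Longrightarrow> s \<in> S \<Longrightarrow> s \<le> max (\<rho> * c) e"
    and s: "s \<in> S"
  shows "s \<le> e"
proof (rule ccontr)
  assume neg: "\<not> s \<le> e"
  have upper: "t \<le> Sup S" if "t \<in> S" for t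
    using that S by (rule cSup_upper)
  have "Sup S \<le> max (\<rho> * Sup S) e"
    using s step[OF upper] by (intro cSup_least) blast+
  moreover have "Sup S > e"
    using upper[OF s] neg by simp
  moreover have "\<rho> * Sup S < 1 * Sup S"
    using \<rho> e \<open>Sup S > e\<close> by (intro mult_strict_right_mono) auto
  ultimately show False by auto
qed

subsection \<open>Monotone likelihood ratio order\<close>

lemma beliefs_nonneg: "\<pi> \<in> beliefs \<Longrightarrow> 0 \<le> \<pi> $ i"
  by (simp add: beliefs_def)

lemma beliefs_sum: "\<pi> \<in> beliefs \<Longrightarrow> (\<Sum>i\<in>UNIV. \<pi> $ i) = 1"
  by (simp add: beliefs_def)

lemma beliefs_pos_component:
  assumes "\<pi> \<in> beliefs" obtains k where "0 < \<pi> $ k"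
proof -
  have "\<exists>k. \<pi> $ k \<noteq> 0"
  proof (rule ccontr)
    assume "\<nexists>k. \<pi> $ k \<noteq> 0"
    then have "(\<Sum>i\<in>UNIV. \<pi> $ i) = 0" by simp
    with beliefs_sum[OF assms] show False by simp
  qed
  then show ?thesis
    using that beliefs_nonneg[OF assms] by (metis less_eq_real_def)
qed

lemma mlr_ge_refl: "a \<ge>\<^sub>r a"
  by (simp add: mlr_ge_def)

text \<open>Multiply the two inequalities and cancel \<open>b $ i * b $ j\<close>. If this product
  is 0, a positive component of \<open>b\<close> forces \<open>a $ i = 0\<close> or
  \<open>c $ j = 0\<close>. Normalization matters here: the zero vector is comparable to every
  vector in both directions.\<close>

lemma mlr_ge_trans:
  assumes a: "a \<in> beliefs" and b: "b \<in> beliefs" and c: "c \<in> beliefs"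
    and ab: "a \<ge>\<^sub>r b" and bc: "b \<ge>\<^sub>r c"
  shows "a \<ge>\<^sub>r c"
  unfolding mlr_ge_def
proof (intro allI impI)
  fix i j :: 'a
  assume ij: "i < j"
  note nn = beliefs_nonneg[OF a] beliefs_nonneg[OF b] beliefs_nonneg[OF c]
  have AB: "a $ i * b $ j \<le> b $ i * a $ j" if "i < j" for i j
    using ab that by (simp add: mlr_ge_def)
  have BC: "b $ i * c $ j \<le> c $ i * b $ j" if "i < j" for i j
    using bc that by (simp add: mlr_ge_def)
  have "a $ i = 0 \<or> c $ j = 0" if zero: "b $ i = 0 \<or> b $ j = 0"
  proof -
    obtain k where k: "0 < b $ k" using beliefs_pos_component[OF b] .
    have a0: "a $ i = 0" if "b $ i = 0" "i < k" "0 < b $ k" for k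
    proof -
      have "a $ i * b $ k \<le> 0" using AB[OF \<open>i < k\<close>] that by simp
      then show ?thesis using that nn(1)[of i] by (simp add: mult_le_0_iff)
    qed
    have c0: "c $ j = 0" if "b $ j = 0" "k < j" "0 < b $ k" for k
    proof -
      have "b $ k * c $ j \<le> 0" using BC[OF \<open>k < j\<close>] that by simp
      then show ?thesis using that nn(3)[of j] by (simp add: mult_le_0_iff)
    qed
    show ?thesis
    proof (cases "b $ i = 0")
      case bi: True
      show ?thesis
      proof (cases "i < k")
        case True
        then show ?thesis using a0 bi k by blast
      next
        case False
        \<comment> \<open>If \<open>b $ j = 0\<close>, then \<open>k\<close> witnesses
          \<open>c $ j = 0\<close>; otherwise \<open>j\<close> itself is the positive component
          above \<open>i\<close> and \<open>a $ i = 0\<close>.\<close>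
        then have "k < j" using ij by simp
        then show ?thesis using a0[of j] c0[of k] bi ij k nn(2)[of j] by fastforce
      qed
    next
      case False
      then show ?thesis using zero c0[of i] ij nn(2)[of i] by fastforce
    qed
  qed
  moreover have "a $ i * c $ j \<le> c $ i * a $ j" if pos: "0 < b $ i" "0 < b $ j"
  proof -
    have "(a $ i * b $ j) * (b $ i * c $ j) \<le> (b $ i * a $ j) * (c $ i * b $ j)"
      by (rule mult_mono[OF AB[OF ij] BC[OF ij]]) (use nn in auto)
    then have "(b $ i * b $ j) * (a $ i * c $ j) \<le> (b $ i * b $ j) * (c $ i * a $ j)"
      by (simp add: ac_simps)
    then show ?thesis using pos by (simp add: mult_le_cancel_left)
  qed
  ultimately show "a $ i * c $ j \<le> c $ i * a $ j"
    using nn by (metis less_eq_real_def mult_nonneg_nonneg mult_zero_left mult_zero_right)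
qed

text \<open>The two orders together make the vectors proportional, and equal total mass makes them
  equal.\<close>

lemma mlr_ge_antisym:
  assumes a: "a \<in> beliefs" and b: "b \<in> beliefs" and ab: "a \<ge>\<^sub>r b" "b \<ge>\<^sub>r a"
  shows "a = b"
proof -
  have lt: "a $ i * b $ j = b $ i * a $ j" if "i < j" for i j
    using ab that by (fastforce simp: mlr_ge_def)
  have eq: "a $ i * b $ j = b $ i * a $ j" for i j
    using lt[of i j] lt[of j i] by (cases i j rule: linorder_cases) (auto simp: ac_simps)
  have "a $ i = b $ i" for i
  proof -
    have "a $ i * (\<Sum>j\<in>UNIV. b $ j) = b $ i * (\<Sum>j\<in>UNIV. a $ j)"
      by (simp add: sum_distrib_left eq)
    then show ?thesis using a b by (simp add: beliefs_sum)
  qed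
  then show ?thesis by (simp add: vec_eq_iff)
qed

text \<open>The difference of the two expectations is a double sum over independent draws
  \<open>y\<close> from \<open>s1\<close> and \<open>y'\<close> from \<open>s2\<close>. Draws with
  \<open>y' \<le> y\<close> contribute nonnegatively, and each draw in the wrong order is absorbed
  by its mirror image. Allowing two integrands, compared only where both weights are positive, fits
  filter updates, which are beliefs only at observations of positive probability.\<close>

lemma mlr_expectation_mono:
  assumes s1: "s1 \<in> beliefs" and s2: "s2 \<in> beliefs" and mlr: "s1 \<ge>\<^sub>r s2"
    and w: "\<And>y y'. y' \<le> y \<Longrightarrow> 0 < s1 $ y \<Longrightarrow> 0 < s2 $ y' \<Longrightarrow> w2 y' \<le> w1 y"
  shows "(\<Sum>y\<in>UNIV. w2 y * s2 $ y) \<le> (\<Sum>y\<in>UNIV. w1 y * s1 $ y)"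
proof -
  define g where "g y y' = s1 $ y * s2 $ y' * (w1 y - w2 y')" for y y'
  note nn = beliefs_nonneg[OF s1] beliefs_nonneg[OF s2]
  have g_nonneg: "0 \<le> g y y'" if "y' \<le> y" for y y'
  proof (cases "s1 $ y = 0 \<or> s2 $ y' = 0")
    case True
    then show ?thesis by (auto simp: g_def)
  next
    case False
    then have "w2 y' \<le> w1 y" using w that nn by (metis less_eq_real_def)
    then show ?thesis by (simp add: g_def nn)
  qed
  have g_lt: "0 \<le> g y y' + g y' y" if yy: "y' < y" for y y'
  proof (cases "s1 $ y' = 0 \<or> s2 $ y = 0")
    case True
    then have "g y' y = 0" by (auto simp: g_def)
    then show ?thesis using g_nonneg[of y' y] yy by simp
  next
    case False
    then have pos: "0 < s1 $ y'" "0 < s2 $ y" using nn by (metis less_eq_real_def)+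
    have le: "s1 $ y' * s2 $ y \<le> s1 $ y * s2 $ y'"
      using mlr yy by (simp add: mlr_ge_def ac_simps)
    have "0 < s1 $ y * s2 $ y'" using le pos by (smt (verit) mult_pos_pos)
    then have pos': "0 < s1 $ y" "0 < s2 $ y'"
      using nn by (metis less_eq_real_def mult_zero_left mult_zero_right)+
    \<comment> \<open>Lower the weight of the well-ordered pair to that of its mirror; the four
      values then regroup into the diagonal differences \<open>w1 y - w2 y\<close> and
      \<open>w1 y' - w2 y'\<close>.\<close>
    have "(s1 $ y' * s2 $ y) * (w1 y - w2 y') \<le> g y y'"
      unfolding g_def using le w[of y' y] yy pos' by (intro mult_right_mono) auto
    moreover have "0 \<le> (s1 $ y' * s2 $ y) * ((w1 y - w2 y') + (w1 y' - w2 y))"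
      using w[of y y] w[of y' y'] pos pos' by (intro mult_nonneg_nonneg) auto
    ultimately show ?thesis by (simp add: g_def distrib_left)
  qed
  have "0 \<le> (\<Sum>y\<in>UNIV. \<Sum>y'\<in>UNIV. g y y')"
  proof (rule double_sum_nonneg_if_symmetrized_nonneg)
    show "0 \<le> g i j + g j i" for i j
      using g_lt[of i j] g_lt[of j i] g_nonneg[of i i]
      by (cases i j rule: linorder_cases) auto
  qed
  also have "\<dots> = (\<Sum>y\<in>UNIV. w1 y * s1 $ y) * (\<Sum>y'\<in>UNIV. s2 $ y')
      - (\<Sum>y\<in>UNIV. s1 $ y) * (\<Sum>y'\<in>UNIV. w2 y' * s2 $ y')"
    unfolding sum_product g_def by (simp add: right_diff_distrib sum_subtractf ac_simps)
  finally show ?thesis using s1 s2 by (simp add: beliefs_sum)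
qed

text \<open>This simp rule would turn \<open>transpose A *v p\<close> into a \<open>v*\<close>
  product, whereas the filter is written with \<open>transpose\<close>.\<close>

declare transpose_matrix_vector [simp del]

section \<open>Action of stochastic and TP2 matrices on beliefs\<close>

lemma transpose_mult_component: "(transpose A *v p) $ k = (\<Sum>i\<in>UNIV. A $ i $ k * p $ i)"
  by (simp add: matrix_vector_mult_def transpose_def)

lemma transpose_stochastic_beliefs:
  fixes A :: "real^'n^'m"
  assumes A: "stochastic_matrix A" and p: "p \<in> beliefs"
  shows "transpose A *v p \<in> beliefs"
proof -
  have A': "A $ i \<in> beliefs" for i using A by (simp add: stochastic_matrix_def)
  have "(\<Sum>k\<in>UNIV. \<Sum>i\<in>UNIV. A $ i $ k * p $ i) = (\<Sum>i\<in>UNIV. (\<Sum>k\<in>UNIV. A $ i $ k) * p $ i)"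
    by (subst sum.swap) (simp add: sum_distrib_right)
  also have "\<dots> = 1" using A' p by (simp add: beliefs_sum)
  finally show ?thesis
    using A' p by (auto simp: beliefs_def transpose_mult_component intro!: sum_nonneg)
qed

lemma TP2_minor_le:
  assumes "TP2 A" "i \<le> i'" "j \<le> j'"
  shows "A $ i $ j' * A $ i' $ j \<le> A $ i $ j * A $ i' $ j'"
  using assms by (cases "i = i' \<or> j = j'") (auto simp: TP2_def ac_simps)

text \<open>This is Cauchy-Binet for second order minors: symmetrizing \<open>g\<close> yields a
  minor of \<open>A\<close> times a minor of the pair \<open>p2\<close>, \<open>p1\<close>, both
  nonnegative for \<open>i < j\<close>.\<close>

lemma TP2_preserves_mlr:
  fixes A :: "real^'n::{finite,linorder}^'m::{finite,linorder}"
  assumes A: "TP2 A" and p: "p1 \<ge>\<^sub>r p2"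
  shows "transpose A *v p1 \<ge>\<^sub>r transpose A *v p2"
  unfolding mlr_ge_def
proof (intro allI impI)
  fix k l :: 'n
  assume kl: "k < l"
  define g where "g i j = A $ i $ k * A $ j $ l * (p2 $ i * p1 $ j - p1 $ i * p2 $ j)" for i j
  have lt: "0 \<le> g i j + g j i" if "i < j" for i j
  proof -
    have "0 \<le> (A $ i $ k * A $ j $ l - A $ i $ l * A $ j $ k) * (p2 $ i * p1 $ j - p1 $ i * p2 $ j)"
      using TP2_minor_le[OF A, of i j k l] p that kl by (auto simp: mlr_ge_def)
    then show ?thesis by (simp add: g_def algebra_simps)
  qed
  have "0 \<le> (\<Sum>i\<in>UNIV. \<Sum>j\<in>UNIV. g i j)"
  proof (rule double_sum_nonneg_if_symmetrized_nonneg)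
    show "0 \<le> g i j + g j i" for i j
      using lt[of i j] lt[of j i] by (cases i j rule: linorder_cases) (auto simp: g_def)
  qed
  also have "\<dots> = (transpose A *v p2) $ k * (transpose A *v p1) $ l
      - (transpose A *v p1) $ k * (transpose A *v p2) $ l"
    unfolding transpose_mult_component sum_product g_def
    by (simp add: right_diff_distrib sum_subtractf ac_simps)
  finally show "(transpose A *v p1) $ k * (transpose A *v p2) $ l
      \<le> (transpose A *v p2) $ k * (transpose A *v p1) $ l"
    by simp
qed

subsection \<open>The filter\<close>

lemma obs_diag_mult_component: "(obs_diag B y *v p) $ i = B $ i $ y * p $ i"
  by (simp add: matrix_vector_mult_def obs_diag_def if_distrib[of "\<lambda>c. c * _"] cong: if_cong)

text \<open>Exhibits the observation law as two successive kernels, \<open>P\<close> and then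
  \<open>B\<close>, so that the preservation lemmas can be applied twice.\<close>

lemma obs_prob_eq: "obs_prob P B \<pi> y = (transpose B *v (transpose P *v \<pi>)) $ y"
  by (simp add: obs_prob_def inner_vec_def obs_diag_mult_component transpose_mult_component[of B])

lemma belief_update_component:
  "belief_update P B \<pi> y $ i = B $ i $ y * (transpose P *v \<pi>) $ i / obs_prob P B \<pi> y"
  by (simp add: belief_update_def obs_diag_mult_component)

lemma obs_prob_beliefs:
  assumes "stochastic_matrix P" "stochastic_matrix B" "\<pi> \<in> beliefs"
  shows "(\<chi> y. obs_prob P B \<pi> y) \<in> beliefs"
proof -
  have "(\<chi> y. obs_prob P B \<pi> y) = transpose B *v (transpose P *v \<pi>)"
    by (simp add: vec_eq_iff obs_prob_eq)
  then show ?thesis by (simp add: transpose_stochastic_beliefs assms)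
qed

lemma obs_prob_mlr:
  assumes "TP2 P" "TP2 B" "\<pi>\<^sub>1 \<ge>\<^sub>r \<pi>\<^sub>2"
  shows "(\<chi> y. obs_prob P B \<pi>\<^sub>1 y) \<ge>\<^sub>r (\<chi> y. obs_prob P B \<pi>\<^sub>2 y)"
proof -
  have "(\<chi> y. obs_prob P B \<pi> y) = transpose B *v (transpose P *v \<pi>)" for \<pi>
    by (simp add: vec_eq_iff obs_prob_eq)
  then show ?thesis by (simp add: TP2_preserves_mlr assms)
qed

lemma belief_update_beliefs:
  assumes P: "stochastic_matrix P" and B: "stochastic_matrix B" and \<pi>: "\<pi> \<in> beliefs"
    and pos: "0 < obs_prob P B \<pi> y"
  shows "belief_update P B \<pi> y \<in> beliefs"
proof -
  have nn: "0 \<le> B $ i $ y" "0 \<le> (transpose P *v \<pi>) $ i" for i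
    using B beliefs_nonneg transpose_stochastic_beliefs[OF P \<pi>]
    by (auto simp: stochastic_matrix_def)
  have "(\<Sum>i\<in>UNIV. belief_update P B \<pi> y $ i) = obs_prob P B \<pi> y / obs_prob P B \<pi> y"
    unfolding belief_update_component sum_divide_distrib[symmetric]
    by (simp add: obs_prob_eq transpose_mult_component[of B])
  then show ?thesis
    using pos nn by (simp add: beliefs_def belief_update_component)
qed

text \<open>TP2 of \<open>P\<close> orders the predictions and TP2 of \<open>B\<close> orders the
  likelihoods of \<open>y'\<close> and \<open>y\<close>. The two inequalities multiply, and both
  sides carry the same positive normalizing product.\<close>

lemma belief_update_mlr:
  fixes P :: "real^'x::{finite,linorder}^'x::{finite,linorder}"
    and B :: "real^'y::{finite,linorder}^'x::{finite,linorder}"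
  assumes P: "stochastic_matrix P" "TP2 P" and B: "stochastic_matrix B" "TP2 B"
    and \<pi>: "\<pi>\<^sub>1 \<in> beliefs" "\<pi>\<^sub>2 \<in> beliefs" "\<pi>\<^sub>1 \<ge>\<^sub>r \<pi>\<^sub>2"
    and y: "y' \<le> y" and pos: "0 < obs_prob P B \<pi>\<^sub>1 y" "0 < obs_prob P B \<pi>\<^sub>2 y'"
  shows "belief_update P B \<pi>\<^sub>1 y \<ge>\<^sub>r belief_update P B \<pi>\<^sub>2 y'"
  unfolding mlr_ge_def
proof (intro allI impI)
  fix i j :: 'x
  assume ij: "i < j"
  define p1 p2 where "p1 = transpose P *v \<pi>\<^sub>1" and "p2 = transpose P *v \<pi>\<^sub>2"
  have nn: "0 \<le> p1 $ k" "0 \<le> p2 $ k" "0 \<le> B $ k $ z" for k z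
    using B(1) beliefs_nonneg transpose_stochastic_beliefs[OF P(1) \<pi>(1)]
      transpose_stochastic_beliefs[OF P(1) \<pi>(2)]
    unfolding p1_def p2_def stochastic_matrix_def by blast+
  have p: "p1 $ i * p2 $ j \<le> p2 $ i * p1 $ j"
    using TP2_preserves_mlr[OF P(2) \<pi>(3)] ij by (simp add: mlr_ge_def p1_def p2_def)
  have "(B $ i $ y * B $ j $ y') * (p1 $ i * p2 $ j) \<le> (B $ i $ y' * B $ j $ y) * (p2 $ i * p1 $ j)"
    using TP2_minor_le[OF B(2), of i j y' y] ij y by (intro mult_mono[OF _ p]) (auto simp: nn)
  then have "(B $ i $ y * p1 $ i) * (B $ j $ y' * p2 $ j) / (obs_prob P B \<pi>\<^sub>1 y * obs_prob P B \<pi>\<^sub>2 y')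
      \<le> (B $ i $ y' * p2 $ i) * (B $ j $ y * p1 $ j) / (obs_prob P B \<pi>\<^sub>1 y * obs_prob P B \<pi>\<^sub>2 y')"
    using pos by (intro divide_right_mono) (auto simp: ac_simps)
  then show "belief_update P B \<pi>\<^sub>1 y $ i * belief_update P B \<pi>\<^sub>2 y' $ j
      \<le> belief_update P B \<pi>\<^sub>2 y' $ i * belief_update P B \<pi>\<^sub>1 y $ j"
    by (simp add: belief_update_component p1_def p2_def ac_simps)
qed

subsection \<open>The retirement problem\<close>

context
  fixes P :: "real^'x::{finite,linorder}^'x::{finite,linorder}"
    and B :: "real^'y::{finite,linorder}^'x::{finite,linorder}"
    and r :: "real^'x::{finite,linorder}" and \<rho> :: real
    and V :: "real^'x::{finite,linorder} \<Rightarrow> real \<Rightarrow> real"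
  assumes P: "stochastic_matrix P" and B: "stochastic_matrix B"
    and \<rho>: "0 \<le> \<rho>" "\<rho> < 1"
    and r_nonneg: "\<And>i. 0 \<le> r $ i"
    and V: "retirement_value P B r \<rho> V"
begin

abbreviation M_max :: real where
  "M_max \<equiv> Max (range (\<lambda>i. r $ i)) / (1 - \<rho>)"

abbreviation continuation :: "real \<Rightarrow> real^'x::{finite,linorder} \<Rightarrow> real" where
  "continuation M \<pi> \<equiv> (\<Sum>y\<in>UNIV. V (belief_update P B \<pi> y) M * obs_prob P B \<pi> y)"

lemma bellman:
  "M \<in> retirement_rewards r \<rho> \<Longrightarrow> \<pi> \<in> beliefs \<Longrightarrow> V \<pi> M = max (r \<bullet> \<pi> + \<rho> * continuation M \<pi>) M"
  using V unfolding retirement_value_def by blast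

lemma retirement_value_bounds:
  assumes "M \<in> retirement_rewards r \<rho>"
  obtains C where "\<And>\<pi>. \<pi> \<in> beliefs \<Longrightarrow> \<bar>V \<pi> M\<bar> \<le> C"
proof -
  have "bounded ((\<lambda>\<pi>. V \<pi> M) ` beliefs)"
    using assms V unfolding retirement_value_def by blast
  then show ?thesis using that by (auto simp: bounded_iff)
qed

lemma obs_prob_nonneg: "\<pi> \<in> beliefs \<Longrightarrow> 0 \<le> obs_prob P B \<pi> y"
  using beliefs_nonneg[OF obs_prob_beliefs[OF P B], of \<pi> y] by simp

lemma obs_prob_sum: "\<pi> \<in> beliefs \<Longrightarrow> (\<Sum>y\<in>UNIV. obs_prob P B \<pi> y) = 1"
  using beliefs_sum[OF obs_prob_beliefs[OF P B], of \<pi>] by simp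

text \<open>Observations of probability 0, whose update is not a belief, contribute 0 to both sums;
  the constant passes through because the probabilities sum to 1.\<close>

lemma expected_update_le:
  assumes \<pi>: "\<pi> \<in> beliefs" and le: "\<And>\<pi>'. \<pi>' \<in> beliefs \<Longrightarrow> f \<pi>' \<le> g \<pi>' + c"
  shows "(\<Sum>y\<in>UNIV. f (belief_update P B \<pi> y) * obs_prob P B \<pi> y)
    \<le> (\<Sum>y\<in>UNIV. g (belief_update P B \<pi> y) * obs_prob P B \<pi> y) + c"
proof -
  have "f (belief_update P B \<pi> y) * obs_prob P B \<pi> y
      \<le> (g (belief_update P B \<pi> y) + c) * obs_prob P B \<pi> y" for y
    using le[OF belief_update_beliefs[OF P B \<pi>, of y]] obs_prob_nonneg[OF \<pi>, of y]
    by (cases "obs_prob P B \<pi> y = 0") (auto intro!: mult_right_mono)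
  then have "(\<Sum>y\<in>UNIV. f (belief_update P B \<pi> y) * obs_prob P B \<pi> y)
      \<le> (\<Sum>y\<in>UNIV. (g (belief_update P B \<pi> y) + c) * obs_prob P B \<pi> y)"
    by (rule sum_mono)
  also have "\<dots> = (\<Sum>y\<in>UNIV. g (belief_update P B \<pi> y) * obs_prob P B \<pi> y)
      + c * (\<Sum>y\<in>UNIV. obs_prob P B \<pi> y)"
    by (simp add: distrib_right sum.distrib sum_distrib_left)
  finally show ?thesis by (simp add: obs_prob_sum[OF \<pi>])
qed

lemma retirement_value_ge: "M \<in> retirement_rewards r \<rho> \<Longrightarrow> \<pi> \<in> beliefs \<Longrightarrow> M \<le> V \<pi> M"
  by (simp add: bellman)

lemma M_max_mem: "M_max \<in> retirement_rewards r \<rho>"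
proof -
  have "r $ undefined \<le> Max (range (\<lambda>i. r $ i))" by (rule Max_ge) auto
  then have "0 \<le> Max (range (\<lambda>i. r $ i))" using r_nonneg[of undefined] by linarith
  then show ?thesis using \<rho> by (simp add: retirement_rewards_def)
qed

lemma reward_le: "\<pi> \<in> beliefs \<Longrightarrow> r \<bullet> \<pi> \<le> (1 - \<rho>) * M_max"
proof -
  assume \<pi>: "\<pi> \<in> beliefs"
  have "r \<bullet> \<pi> \<le> (\<Sum>i\<in>UNIV. Max (range (\<lambda>i. r $ i)) * \<pi> $ i)"
    unfolding inner_vec_def
    by (intro sum_mono) (auto intro!: mult_right_mono beliefs_nonneg[OF \<pi>])
  also have "\<dots> = Max (range (\<lambda>i. r $ i))"
    using \<pi> by (simp add: beliefs_sum flip: sum_distrib_left)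
  finally show ?thesis using \<rho> by simp
qed

text \<open>\<open>M_max\<close> is the discounted value of earning the largest reward forever, so
  retiring cannot be beaten. Formally, if the excess over \<open>M_max\<close> is at most
  \<open>c\<close>, one Bellman step reduces the bound to \<open>max (\<rho> * c) 0\<close>.\<close>

lemma retirement_value_M_max:
  assumes \<pi>: "\<pi> \<in> beliefs"
  shows "V \<pi> M_max = M_max"
proof -
  define M where "M = M_max"
  have M: "M \<in> retirement_rewards r \<rho>" unfolding M_def by (rule M_max_mem)
  obtain C where C: "\<And>\<pi>. \<pi> \<in> beliefs \<Longrightarrow> \<bar>V \<pi> M\<bar> \<le> C"
    using retirement_value_bounds[OF M] by blast
  have "V \<pi> M - M \<le> 0"
  proof (rule le_of_contraction[OF \<rho> order.refl, where S = "(\<lambda>\<pi>. V \<pi> M - M) ` beliefs"])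
    show "bdd_above ((\<lambda>\<pi>. V \<pi> M - M) ` beliefs)"
      using C by (intro bdd_aboveI2[where M = "C - M"]) fastforce
  next
    fix c s
    assume c: "\<And>t. t \<in> (\<lambda>\<pi>. V \<pi> M - M) ` beliefs \<Longrightarrow> t \<le> c"
      and "s \<in> (\<lambda>\<pi>. V \<pi> M - M) ` beliefs"
    then obtain p where p: "p \<in> beliefs" "s = V p M - M" by blast
    have "continuation M p \<le> (\<Sum>y\<in>UNIV. M * obs_prob P B p y) + c"
      using c by (intro expected_update_le[OF p(1), of "\<lambda>\<pi>. V \<pi> M" "\<lambda>_. M"]) force
    then have "\<rho> * continuation M p \<le> \<rho> * (M + c)"
      using \<rho> by (intro mult_left_mono) (simp_all add: obs_prob_sum[OF p(1)] flip: sum_distrib_left)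
    moreover have "r \<bullet> p \<le> (1 - \<rho>) * M"
      using reward_le[OF p(1)] by (simp add: M_def)
    ultimately have "r \<bullet> p + \<rho> * continuation M p \<le> M + \<rho> * c"
      by (simp add: algebra_simps)
    then show "s \<le> max (\<rho> * c) 0"
      using bellman[OF M p(1)] p(2) by linarith
  qed (use \<pi> in blast)
  then show ?thesis
    using retirement_value_ge[OF M \<pi>] by (simp add: M_def)
qed

text \<open>The retirement branches differ by at most \<open>\<bar>M - N\<bar>\<close> and the
  continuation branches by at most \<open>\<rho> * c\<close>. This supplies the continuity in
  \<open>M\<close> behind the existence of the index.\<close>

lemma retirement_value_lipschitz:
  assumes M: "M \<in> retirement_rewards r \<rho>" "N \<in> retirement_rewards r \<rho>" and \<pi>: "\<pi> \<in> beliefs"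
  shows "V \<pi> M - V \<pi> N \<le> \<bar>M - N\<bar>"
proof -
  obtain C where C: "\<And>\<pi>. \<pi> \<in> beliefs \<Longrightarrow> \<bar>V \<pi> M\<bar> \<le> C"
    using retirement_value_bounds[OF M(1)] by blast
  obtain D where D: "\<And>\<pi>. \<pi> \<in> beliefs \<Longrightarrow> \<bar>V \<pi> N\<bar> \<le> D"
    using retirement_value_bounds[OF M(2)] by blast
  show ?thesis
  proof (rule le_of_contraction[OF \<rho> abs_ge_zero, where S = "(\<lambda>\<pi>. V \<pi> M - V \<pi> N) ` beliefs"])
    show "bdd_above ((\<lambda>\<pi>. V \<pi> M - V \<pi> N) ` beliefs)"
      using C D by (intro bdd_aboveI2[where M = "C + D"]) fastforce
  next
    fix c s
    assume c: "\<And>t. t \<in> (\<lambda>\<pi>. V \<pi> M - V \<pi> N) ` beliefs \<Longrightarrow> t \<le> c"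
      and "s \<in> (\<lambda>\<pi>. V \<pi> M - V \<pi> N) ` beliefs"
    then obtain p where p: "p \<in> beliefs" "s = V p M - V p N" by blast
    have "continuation M p \<le> continuation N p + c"
      using c by (intro expected_update_le[OF p(1), of "\<lambda>\<pi>. V \<pi> M" "\<lambda>\<pi>. V \<pi> N"]) force
    then have "\<rho> * continuation M p \<le> \<rho> * (continuation N p + c)"
      using \<rho> by (intro mult_left_mono)
    then show "s \<le> max (\<rho> * c) \<bar>M - N\<bar>"
      using bellman[OF M(1) p(1)] bellman[OF M(2) p(1)] p(2) by (simp add: distrib_left)
  qed (use \<pi> in blast)
qed

text \<open>\<open>LEAST\<close> over the reals is meaningful only if the minimum is attained. The
  candidates form the zero set of a continuous function on a compact interval; it is closed,
  contains \<open>M_max\<close> and is bounded below, hence contains its infimum.\<close>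

lemma gittins_index_properties:
  assumes \<pi>: "\<pi> \<in> beliefs"
  shows gittins_index_mem: "gittins_index r \<rho> V \<pi> \<in> retirement_rewards r \<rho>"
    and gittins_index_retire: "V \<pi> (gittins_index r \<rho> V \<pi>) = gittins_index r \<rho> V \<pi>"
    and gittins_index_least:
      "\<And>M. M \<in> retirement_rewards r \<rho> \<Longrightarrow> V \<pi> M = M \<Longrightarrow> gittins_index r \<rho> V \<pi> \<le> M"
proof -
  define S where "S = {M \<in> retirement_rewards r \<rho>. V \<pi> M - M = 0}"
  have "dist (V \<pi> M) (V \<pi> N) \<le> 1 * dist M N"
    if "M \<in> retirement_rewards r \<rho>" "N \<in> retirement_rewards r \<rho>" for M N
    using retirement_value_lipschitz[OF that \<pi>] retirement_value_lipschitz[OF that(2,1) \<pi>]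
    by (auto simp: dist_real_def)
  then have "1-lipschitz_on (retirement_rewards r \<rho>) (V \<pi>)"
    by (intro lipschitz_onI) auto
  then have "continuous_on (retirement_rewards r \<rho>) (\<lambda>M. V \<pi> M - M)"
    by (intro continuous_intros) (auto intro: lipschitz_on_continuous_on)
  then have "closed S"
    unfolding S_def retirement_rewards_def
    by (intro continuous_closed_preimage_constant) auto
  moreover have "M_max \<in> S"
    using M_max_mem retirement_value_M_max[OF \<pi>] by (simp add: S_def)
  moreover have bdd: "bdd_below S"
    by (rule bdd_belowI[where m = 0]) (auto simp: S_def retirement_rewards_def)
  ultimately have Inf: "Inf S \<in> S"
    by (intro closed_contains_Inf) auto
  have "gittins_index r \<rho> V \<pi> = Inf S"
    unfolding gittins_index_def using Inf cInf_lower[OF _ bdd]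
    by (intro Least_equality) (auto simp: S_def)
  then show "gittins_index r \<rho> V \<pi> \<in> retirement_rewards r \<rho>"
    and "V \<pi> (gittins_index r \<rho> V \<pi>) = gittins_index r \<rho> V \<pi>"
    and "\<And>M. M \<in> retirement_rewards r \<rho> \<Longrightarrow> V \<pi> M = M \<Longrightarrow> gittins_index r \<rho> V \<pi> \<le> M"
    using Inf cInf_lower[OF _ bdd] by (auto simp: S_def)
qed

section \<open>Monotonicity of the value and of the index in the belief\<close>

context
  assumes r_mono: "mono (\<lambda>i. r $ i)" and P_TP2: "TP2 P" and B_TP2: "TP2 B"
begin

text \<open>The contraction runs over ordered pairs of beliefs: updating the pair with observations
  \<open>y' \<le> y\<close> of positive probability gives an ordered pair again, so its difference
  also lies in \<open>S\<close>.\<close>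

lemma retirement_value_mlr_increasing:
  assumes M: "M \<in> retirement_rewards r \<rho>"
  shows "mlr_increasing (\<lambda>\<pi>. V \<pi> M)"
  unfolding mlr_increasing_def
proof (intro ballI impI)
  fix \<pi>\<^sub>1 \<pi>\<^sub>2 :: "real^'x::{finite,linorder}"
  assume \<pi>: "\<pi>\<^sub>1 \<in> beliefs" "\<pi>\<^sub>2 \<in> beliefs" "\<pi>\<^sub>1 \<ge>\<^sub>r \<pi>\<^sub>2"
  define S where "S = {V q M - V p M | p q. p \<in> beliefs \<and> q \<in> beliefs \<and> p \<ge>\<^sub>r q}"
  obtain C where C: "\<And>\<pi>. \<pi> \<in> beliefs \<Longrightarrow> \<bar>V \<pi> M\<bar> \<le> C"
    using retirement_value_bounds[OF M] by blast
  have "V \<pi>\<^sub>2 M - V \<pi>\<^sub>1 M \<le> 0"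
  proof (rule le_of_contraction[OF \<rho> order.refl, where S = S])
    show "bdd_above S"
      unfolding S_def
    proof (intro bdd_aboveI[where M = "C + C"], clarify)
      fix p q :: "real^'x::{finite,linorder}"
      assume "p \<in> beliefs" "q \<in> beliefs"
      then show "V q M - V p M \<le> C + C" using C[of p] C[of q] by linarith
    qed
  next
    fix c s
    assume c: "\<And>t. t \<in> S \<Longrightarrow> t \<le> c" and "s \<in> S"
    then obtain p q where pq: "p \<in> beliefs" "q \<in> beliefs" "p \<ge>\<^sub>r q" "s = V q M - V p M"
      by (auto simp: S_def)
    have "(\<Sum>i\<in>UNIV. r $ i * q $ i) \<le> (\<Sum>i\<in>UNIV. r $ i * p $ i)"
      using r_mono pq by (intro mlr_expectation_mono) (auto simp: mono_def)
    then have reward: "r \<bullet> q \<le> r \<bullet> p" by (simp add: inner_vec_def)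
    have V_le: "V (belief_update P B q y') M \<le> V (belief_update P B p y) M + c"
      if y: "y' \<le> y" and pos: "0 < obs_prob P B p y" "0 < obs_prob P B q y'" for y y'
    proof -
      have "V (belief_update P B q y') M - V (belief_update P B p y) M \<in> S"
        unfolding S_def
        using belief_update_mlr[OF P P_TP2 B B_TP2 pq(1-3) y pos]
          belief_update_beliefs[OF P B pq(1) pos(1)] belief_update_beliefs[OF P B pq(2) pos(2)]
        by blast
      from c[OF this] show ?thesis by simp
    qed
    \<comment> \<open>The slack \<open>c\<close> goes into the integrand on the side of
      \<open>p\<close>, so the two-integrand comparison applies although \<open>V\<close> is not yet
      known to be increasing.\<close>
    have "continuation M q \<le> (\<Sum>y\<in>UNIV. (V (belief_update P B p y) M + c) * obs_prob P B p y)"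
      using mlr_expectation_mono[OF obs_prob_beliefs[OF P B pq(1)] obs_prob_beliefs[OF P B pq(2)]
          obs_prob_mlr[OF P_TP2 B_TP2 pq(3)],
          of "\<lambda>y. V (belief_update P B q y) M" "\<lambda>y. V (belief_update P B p y) M + c"] V_le
      by simp
    also have "\<dots> = continuation M p + c * (\<Sum>y\<in>UNIV. obs_prob P B p y)"
      by (simp add: distrib_right sum.distrib sum_distrib_left)
    finally have "continuation M q \<le> continuation M p + c"
      by (simp add: obs_prob_sum[OF pq(1)])
    then have "\<rho> * continuation M q \<le> \<rho> * (continuation M p + c)"
      using \<rho> by (intro mult_left_mono)
    then show "s \<le> max (\<rho> * c) 0"
      using reward bellman[OF M pq(1)] bellman[OF M pq(2)] pq(4) by (simp add: distrib_left)
  qed (use \<pi> in \<open>auto simp: S_def\<close>)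
  then show "V \<pi>\<^sub>2 M \<le> V \<pi>\<^sub>1 M" by simp
qed

text \<open>At the index \<open>?M\<close> of the larger belief,
  \<open>?M \<le> V \<pi>\<^sub>2 ?M \<le> V \<pi>\<^sub>1 ?M = ?M\<close>, so \<open>?M\<close> is
  a candidate in the minimum for the smaller belief.\<close>

lemma gittins_index_mlr_increasing: "mlr_increasing (gittins_index r \<rho> V)"
  unfolding mlr_increasing_def
proof (intro ballI impI)
  fix \<pi>\<^sub>1 \<pi>\<^sub>2 :: "real^'x::{finite,linorder}"
  assume \<pi>: "\<pi>\<^sub>1 \<in> beliefs" "\<pi>\<^sub>2 \<in> beliefs" "\<pi>\<^sub>1 \<ge>\<^sub>r \<pi>\<^sub>2"
  let ?M = "gittins_index r \<rho> V \<pi>\<^sub>1"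
  have M: "?M \<in> retirement_rewards r \<rho>" using gittins_index_mem[OF \<pi>(1)] .
  have "V \<pi>\<^sub>2 ?M \<le> V \<pi>\<^sub>1 ?M"
    using retirement_value_mlr_increasing[OF M] \<pi> by (auto simp: mlr_increasing_def)
  then have "V \<pi>\<^sub>2 ?M = ?M"
    using gittins_index_retire[OF \<pi>(1)] retirement_value_ge[OF M \<pi>(2)] by simp
  then show "gittins_index r \<rho> V \<pi>\<^sub>2 \<le> ?M"
    using gittins_index_least[OF \<pi>(2) M] by simp
qed

end

end

subsection \<open>Opportunistic policies\<close>

text \<open>MLR is a partial order on beliefs, so a maximal element exists in a finite set. It need
  not be a greatest one, as the profile may contain incomparable beliefs.\<close>

lemma ex_mlr_maximal:
  fixes b :: "'l::finite \<Rightarrow> real^'x::{finite,linorder}"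
  assumes b: "b \<in> profiles" and A: "A \<noteq> {}"
  shows "\<exists>l\<in>A. \<forall>m\<in>A. b m \<ge>\<^sub>r b l \<longrightarrow> b m = b l"
proof -
  \<comment> \<open>Distinct projects may carry equal beliefs, so strictness is measured on beliefs
    and not on projects.\<close>
  define R where "R l m \<longleftrightarrow> b m \<ge>\<^sub>r b l \<and> b m \<noteq> b l" for l m
  have bel: "b l \<in> beliefs" for l using b by (simp add: profiles_def)
  have "asymp_on A R"
    using mlr_ge_antisym[OF bel bel] by (auto simp: R_def intro!: asymp_onI)
  moreover have "transp_on A R"
    using mlr_ge_antisym[OF bel bel] mlr_ge_trans[OF bel bel bel]
    unfolding R_def by (intro transp_onI) metis
  ultimately obtain l where "l \<in> A" "\<forall>m\<in>A. m \<noteq> l \<longrightarrow> \<not> R l m"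
    using Finite_Set.bex_max_element[of A R] A by auto
  then show ?thesis by (auto simp: R_def)
qed

lemma mlr_argmax_nonempty:
  fixes b :: "'l::finite \<Rightarrow> real^'x::{finite,linorder}"
  assumes "b \<in> profiles" "mlr_comparable b"
  shows "mlr_argmax b \<noteq> {}"
proof -
  obtain l where "\<forall>m. b m \<ge>\<^sub>r b l \<longrightarrow> b m = b l"
    using ex_mlr_maximal[OF assms(1), of UNIV] by auto
  then have "l \<in> mlr_argmax b"
    using assms(2) mlr_ge_refl by (fastforce simp: mlr_argmax_def mlr_comparable_def)
  then show ?thesis by blast
qed

lemma mlr_argmax_subset_index_argmax:
  assumes "mlr_increasing \<gamma>" "b \<in> profiles"
  shows "mlr_argmax b \<subseteq> index_argmax \<gamma> b"
  using assms by (auto simp: mlr_increasing_def profiles_def mlr_argmax_def index_argmax_def)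

lemma index_argmax_nonempty:
  fixes b :: "'l::finite \<Rightarrow> real^'x"
  shows "index_argmax \<gamma> b \<noteq> {}"
proof -
  have "Max (range (\<lambda>l. \<gamma> (b l))) \<in> range (\<lambda>l. \<gamma> (b l))" by (rule Max_in) auto
  then obtain l where l: "Max (range (\<lambda>l. \<gamma> (b l))) = \<gamma> (b l)" by blast
  have "\<gamma> (b m) \<le> \<gamma> (b l)" for m
    unfolding l[symmetric] by (rule Max_ge) auto
  then show ?thesis by (auto simp: index_argmax_def)
qed

text \<open>Choosing an MLR maximal project among those of largest index shows that the tie-breaking
  convention can be met, so statements about such policies are not vacuous.\<close>

lemma ex_tie_breaking_index_policy:
  fixes \<gamma> :: "real^'x::{finite,linorder} \<Rightarrow> real"
  shows "\<exists>\<mu> :: ('x::{finite,linorder}, 'l::finite) policy. index_policy \<gamma> \<mu> \<and> mlr_tie_breaking \<gamma> \<mu>"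
proof -
  define Q where "Q b l \<longleftrightarrow> l \<in> index_argmax \<gamma> b \<and>
      (\<forall>m\<in>index_argmax \<gamma> b. b m \<ge>\<^sub>r b l \<longrightarrow> b m = b l)" for b :: "'l \<Rightarrow> real^'x::{finite,linorder}" and l
  define \<mu> where "\<mu> b = (SOME l. Q b l)" for b
  have "Q b (\<mu> b)" if "b \<in> profiles" for b
    using ex_mlr_maximal[OF that index_argmax_nonempty[of \<gamma> b]] unfolding \<mu>_def
    by (intro someI_ex[of "Q b"]) (auto simp: Q_def)
  then have "index_policy \<gamma> \<mu> \<and> mlr_tie_breaking \<gamma> \<mu>"
    unfolding index_policy_def mlr_tie_breaking_def Q_def by blast
  then show ?thesis by blast
qed

text \<open>An MLR greatest project also has the largest index, so the convention applies to it and
  forces the chosen project to carry the same belief.\<close>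

lemma tie_breaking_index_policy_opportunistic:
  fixes \<mu> :: "('x::{finite,linorder}, 'l::finite) policy"
  assumes \<gamma>: "mlr_increasing \<gamma>" and \<mu>: "mlr_tie_breaking \<gamma> \<mu>"
  shows "opportunistic \<mu>"
  unfolding opportunistic_def
proof (intro ballI impI)
  fix b :: "'l \<Rightarrow> real^'x::{finite,linorder}"
  assume b: "b \<in> profiles" "mlr_comparable b"
  obtain l where l: "l \<in> mlr_argmax b" using mlr_argmax_nonempty[OF b] by blast
  then have "l \<in> index_argmax \<gamma> b" "b l \<ge>\<^sub>r b (\<mu> b)"
    using mlr_argmax_subset_index_argmax[OF \<gamma> b(1)] by (auto simp: mlr_argmax_def)
  then have "b l = b (\<mu> b)" using \<mu> b(1) by (auto simp: mlr_tie_breaking_def)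
  then show "\<mu> b \<in> mlr_argmax b" using l by (simp add: mlr_argmax_def)
qed

text \<open>Comparable beliefs may tie in the index, so opportunism appears in two forms:
  tie-breaking index policies are opportunistic, and opportunistic policies that follow the index on
  the remaining profiles are optimal. The known optimality of index policies enters as the premise
  of the last implication.\<close>

theorem theorem5p4p2:
  fixes P :: "real^'x::{finite,linorder}^'x::{finite,linorder}"
    and B :: "real^'y::{finite,linorder}^'x::{finite,linorder}"
    and r :: "real^'x::{finite,linorder}"
    and \<rho> :: real
    and V :: "real^'x::{finite,linorder} \<Rightarrow> real \<Rightarrow> real"
    and \<gamma> :: "real^'x::{finite,linorder} \<Rightarrow> real"
  assumes P_stochastic: "stochastic_matrix P"
    and B_stochastic: "stochastic_matrix B"
    and discount: "0 \<le> \<rho>" "\<rho> < 1"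
    and r_nonneg: "\<And>i. 0 \<le> r $ i"
    and r_increasing: "mono (\<lambda>i. r $ i)"
    and B_TP2: "TP2 B"
    and P_TP2: "TP2 P"
    and V_value: "retirement_value P B r \<rho> V"
    and gamma_index: "\<gamma> = gittins_index r \<rho> V"
  shows "mlr_increasing \<gamma> \<and>
    (\<forall>b\<in>(profiles :: ('l::finite \<Rightarrow> real^'x::{finite,linorder}) set). mlr_comparable b \<longrightarrow>
       mlr_argmax b \<noteq> {} \<and> mlr_argmax b \<subseteq> index_argmax \<gamma> b) \<and>
    (\<exists>\<mu> :: ('x::{finite,linorder}, 'l::finite) policy. index_policy \<gamma> \<mu> \<and> mlr_tie_breaking \<gamma> \<mu>) \<and>
    (\<forall>\<mu> :: ('x::{finite,linorder}, 'l::finite) policy.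
       index_policy \<gamma> \<mu> \<and> mlr_tie_breaking \<gamma> \<mu> \<longrightarrow> opportunistic \<mu>) \<and>
    ((\<forall>\<mu> :: ('x::{finite,linorder}, 'l::finite) policy.
        index_policy \<gamma> \<mu> \<longrightarrow> optimal_policy P B r \<rho> \<mu>) \<longrightarrow>
     (\<forall>\<mu> :: ('x::{finite,linorder}, 'l::finite) policy.
        opportunistic \<mu> \<and>
        (\<forall>b\<in>profiles. \<not> mlr_comparable b \<longrightarrow> \<mu> b \<in> index_argmax \<gamma> b) \<longrightarrow>
        optimal_policy P B r \<rho> \<mu>))"
proof -
  have \<gamma>: "mlr_increasing \<gamma>"
    unfolding gamma_index
    using gittins_index_mlr_increasing[OF P_stochastic B_stochastic discount r_nonneg V_value
        r_increasing P_TP2 B_TP2] .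
  \<comment> \<open>On comparable profiles an MLR maximum is an index maximum; on the others the
    index is followed by assumption.\<close>
  have "index_policy \<gamma> \<mu>"
    if "opportunistic \<mu>" "\<forall>b\<in>profiles. \<not> mlr_comparable b \<longrightarrow> \<mu> b \<in> index_argmax \<gamma> b"
    for \<mu> :: "('x::{finite,linorder}, 'l) policy"
    using that mlr_argmax_subset_index_argmax[OF \<gamma>]
    unfolding opportunistic_def index_policy_def by blast
  then show ?thesis
    using \<gamma> mlr_argmax_nonempty mlr_argmax_subset_index_argmax[OF \<gamma>] ex_tie_breaking_index_policy
      tie_breaking_index_policy_opportunistic[OF \<gamma>]
    by (intro conjI) blast+
qed

end
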